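(* Consider the Diophantine equation $xy = z^6$ in positive integers $x, y, z$. A triple $(x,y,z)$ of positive integers is a solution of this equation if and only if there exist positive integers $p, e_1, e_2, n_1, n_2, j_1, j_2$ with $\gcd(e_1,e_2)=\gcd(n_1,n_2)=\gcd(j_1,j_2)=1$ such that $$x = p^3 e_1^4 e_2^2 n_1^5 n_2\, j_1^6,\qquad y = p^3 e_1^2 e_2^4 n_1 n_2^5\, j_2^6,\qquad z = p\, e_1 e_2 n_1 n_2 j_1 j_2 .$$ *)

theory Defs
  imports Main
begin

end

theory Submission
  imports Defs "HOL-Computational_Algebra.Primes"
begin

text \<open>The equation says that the exponents \<open>a\<close>, \<open>b\<close> of every prime in \<open>x\<close>, \<open>y\<close> satisfy
  \<open>6 dvd a + b\<close>, so \<open>b mod 6\<close> is determined by \<open>a mod 6\<close>. The residues 4, 2, 5, 1 put the prime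
  into \<open>e1\<close>, \<open>e2\<close>, \<open>n1\<close>, \<open>n2\<close> respectively and the residue 3 contributes one factor to \<open>p\<close>;
  what remains is a pair of exponents \<open>(6 * A, 6 * B)\<close>, whose common part goes into \<open>p\<^sup>3\<close>
  (two factors of \<open>p\<close> per 6) and whose excess goes into \<open>j1\<close> or \<open>j2\<close>.\<close>

lemma exponent_decomposition:
  fixes a b :: nat
  assumes "6 dvd a + b"
  shows "a = 3 * (2 * min (a div 6) (b div 6) + of_bool (a mod 6 = 3))
      + 4 * of_bool (a mod 6 = 4) + 2 * of_bool (a mod 6 = 2)
      + 5 * of_bool (a mod 6 = 5) + of_bool (a mod 6 = 1) + 6 * (a div 6 - b div 6)"
    and "b = 3 * (2 * min (a div 6) (b div 6) + of_bool (a mod 6 = 3))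
      + 2 * of_bool (a mod 6 = 4) + 4 * of_bool (a mod 6 = 2)
      + of_bool (a mod 6 = 5) + 5 * of_bool (a mod 6 = 1) + 6 * (b div 6 - a div 6)"
proof -
  define A B r s where "A = a div 6" and "B = b div 6" and "r = a mod 6" and "s = b mod 6"
  have ab: "a = 6 * A + r" "b = 6 * B + s"
    by (simp_all add: A_def B_def r_def s_def)
  have rs: "r = 0 \<and> s = 0 \<or> r = 1 \<and> s = 5 \<or> r = 2 \<and> s = 4 \<or>
    r = 3 \<and> s = 3 \<or> r = 4 \<and> s = 2 \<or> r = 5 \<and> s = 1"
    using assms unfolding r_def s_def by presburger
  \<comment> \<open>With truncated subtraction, \<open>min A B + (A - B) = A\<close>, so the terms
    \<open>6 * min A B\<close> and \<open>6 * (A - B)\<close> add up to \<open>6 * A\<close>; the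
    indicators supply \<open>r\<close>.\<close>
  have "6 * A + r = 3 * (2 * min A B + of_bool (r = 3)) + 4 * of_bool (r = 4)
      + 2 * of_bool (r = 2) + 5 * of_bool (r = 5) + of_bool (r = 1) + 6 * (A - B)"
    using rs by (cases "A \<le> B") auto
  then show "a = 3 * (2 * min (a div 6) (b div 6) + of_bool (a mod 6 = 3))
      + 4 * of_bool (a mod 6 = 4) + 2 * of_bool (a mod 6 = 2)
      + 5 * of_bool (a mod 6 = 5) + of_bool (a mod 6 = 1) + 6 * (a div 6 - b div 6)"
    by (simp only: A_def B_def r_def mult_div_mod_eq)
  \<comment> \<open>The indicators still test \<open>r\<close>, not \<open>s\<close>: for
    \<open>r > 0\<close> the residue \<open>s\<close> is \<open>6 - r\<close>, hence the
    coefficients 4, 2 and 5, 1 trade places.\<close>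
  have "6 * B + s = 3 * (2 * min A B + of_bool (r = 3)) + 2 * of_bool (r = 4)
      + 4 * of_bool (r = 2) + of_bool (r = 5) + 5 * of_bool (r = 1) + 6 * (B - A)"
    using rs by (cases "A \<le> B") auto
  then show "b = 3 * (2 * min (a div 6) (b div 6) + of_bool (a mod 6 = 3))
      + 2 * of_bool (a mod 6 = 4) + 4 * of_bool (a mod 6 = 2)
      + of_bool (a mod 6 = 5) + 5 * of_bool (a mod 6 = 1) + 6 * (b div 6 - a div 6)"
    by (simp only: A_def B_def r_def s_def mult_div_mod_eq)
qed

text \<open>This allows a number to be defined by prescribing its exponents; vanishing outside the
  finite set \<open>S\<close> makes the product of prime powers finite.\<close>

lemma exists_nat_of_multiplicities:
  fixes f :: "nat \<Rightarrow> nat" and S :: "nat set"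
  assumes "finite S" and "\<And>q. q \<in> S \<Longrightarrow> prime q"
    and "\<And>q. prime q \<Longrightarrow> q \<notin> S \<Longrightarrow> f q = 0"
  obtains n :: nat where "n > 0" and "\<And>q. prime q \<Longrightarrow> multiplicity q n = f q"
proof
  show "(\<Prod>q\<in>S. q ^ f q) > 0"
    using assms(2) by (auto intro!: prod_pos simp: prime_gt_0_nat)
  show "multiplicity q (\<Prod>q\<in>S. q ^ f q) = f q" if "prime q" for q
    using that assms by (simp add: multiplicity_prod_prime_powers)
qed

lemma coprime_of_multiplicities:
  fixes m n :: nat
  assumes "m > 0" and "n > 0"
    and "\<And>q. prime q \<Longrightarrow> multiplicity q m = 0 \<or> multiplicity q n = 0"
  shows "gcd m n = 1"
proof (rule ccontr)
  assume "gcd m n \<noteq> 1"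
  then obtain q where q: "prime q" "q dvd gcd m n"
    using prime_factor_nat by blast
  then have "multiplicity q m > 0" "multiplicity q n > 0"
    using assms(1,2) by (simp_all add: prime_multiplicity_gt_zero_iff)
  with assms(3)[OF q(1)] show False
    by simp
qed

theorem theorem6:
  fixes x y z :: nat
  assumes "x > 0" and "y > 0" and "z > 0"
  shows "x * y = z ^ 6 \<longleftrightarrow>
    (\<exists>p e1 e2 n1 n2 j1 j2 :: nat.
       p > 0 \<and> e1 > 0 \<and> e2 > 0 \<and> n1 > 0 \<and> n2 > 0 \<and> j1 > 0 \<and> j2 > 0 \<and>
       gcd e1 e2 = 1 \<and> gcd n1 n2 = 1 \<and> gcd j1 j2 = 1 \<and>
       x = p ^ 3 * e1 ^ 4 * e2 ^ 2 * n1 ^ 5 * n2 * j1 ^ 6 \<and>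
       y = p ^ 3 * e1 ^ 2 * e2 ^ 4 * n1 * n2 ^ 5 * j2 ^ 6 \<and>
       z = p * e1 * e2 * n1 * n2 * j1 * j2)"
    (is "_ \<longleftrightarrow> ?rhs")
proof
  \<comment> \<open>This identity serves both directions: it gives sufficiency at once, and later it
    recovers \<open>z\<close> from the formulas for \<open>x\<close> and \<open>y\<close>.\<close>
  have product: "(p ^ 3 * e1 ^ 4 * e2 ^ 2 * n1 ^ 5 * n2 * j1 ^ 6) *
      (p ^ 3 * e1 ^ 2 * e2 ^ 4 * n1 * n2 ^ 5 * j2 ^ 6) =
      (p * e1 * e2 * n1 * n2 * j1 * j2) ^ 6" for p e1 e2 n1 n2 j1 j2 :: nat
  proof -
    have "w ^ 6 = w ^ 3 * w ^ 3" "w ^ 6 = w ^ 4 * w ^ 2" "w ^ 6 = w ^ 5 * w" for w :: nat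
      by (simp_all flip: power_add power_Suc2)
    then have "(p * e1 * e2 * n1 * n2 * j1 * j2) ^ 6 =
        (p ^ 3 * p ^ 3) * (e1 ^ 4 * e1 ^ 2) * (e2 ^ 4 * e2 ^ 2) * (n1 ^ 5 * n1) * (n2 ^ 5 * n2)
          * j1 ^ 6 * j2 ^ 6"
      unfolding power_mult_distrib by metis
    then show ?thesis
      by (simp only: ac_simps)
  qed
  {
    assume ?rhs
    then show "x * y = z ^ 6"
      by (elim exE conjE) (simp only: product)
  }
  assume eq: "x * y = z ^ 6"
  define a where "a q = multiplicity q x" for q
  define b where "b q = multiplicity q y" for q
  \<comment> \<open>The condition \<open>g 0 0 = 0\<close> gives finite support, since both
    exponents vanish at primes not dividing \<open>x * y\<close>. Each of the seven parameters is
    one instance of \<open>g\<close>.\<close>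
  have realize: "\<exists>n > 0. \<forall>q. prime q \<longrightarrow> multiplicity q n = g (a q) (b q)"
    if "g 0 0 = 0" for g :: "nat \<Rightarrow> nat \<Rightarrow> nat"
  proof -
    have "g (a q) (b q) = 0" if "prime q" "q \<notin> prime_factors (x * y)" for q
    proof -
      have "\<not> q dvd x" "\<not> q dvd y"
        using that assms by (auto simp: prime_factors_dvd)
      then show ?thesis
        using \<open>g 0 0 = 0\<close> by (simp add: a_def b_def not_dvd_imp_multiplicity_0)
    qed
    then obtain n :: nat where "n > 0" "\<And>q. prime q \<Longrightarrow> multiplicity q n = g (a q) (b q)"
      using exists_nat_of_multiplicities[of "prime_factors (x * y)" "\<lambda>q. g (a q) (b q)"]
      by blast
    then show ?thesis
      by blast
  qed
  obtain p where p: "p > 0" "\<And>q. prime q \<Longrightarrow> multiplicity q p =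
      2 * min (a q div 6) (b q div 6) + of_bool (a q mod 6 = 3)"
    using realize[of "\<lambda>a b. 2 * min (a div 6) (b div 6) + of_bool (a mod 6 = 3)"] by auto
  obtain e1 where e1: "e1 > 0" "\<And>q. prime q \<Longrightarrow> multiplicity q e1 = of_bool (a q mod 6 = 4)"
    using realize[of "\<lambda>a b. of_bool (a mod 6 = 4)"] by auto
  obtain e2 where e2: "e2 > 0" "\<And>q. prime q \<Longrightarrow> multiplicity q e2 = of_bool (a q mod 6 = 2)"
    using realize[of "\<lambda>a b. of_bool (a mod 6 = 2)"] by auto
  obtain n1 where n1: "n1 > 0" "\<And>q. prime q \<Longrightarrow> multiplicity q n1 = of_bool (a q mod 6 = 5)"
    using realize[of "\<lambda>a b. of_bool (a mod 6 = 5)"] by auto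
  obtain n2 where n2: "n2 > 0" "\<And>q. prime q \<Longrightarrow> multiplicity q n2 = of_bool (a q mod 6 = 1)"
    using realize[of "\<lambda>a b. of_bool (a mod 6 = 1)"] by auto
  obtain j1 where j1: "j1 > 0" "\<And>q. prime q \<Longrightarrow> multiplicity q j1 = a q div 6 - b q div 6"
    using realize[of "\<lambda>a b. a div 6 - b div 6"] by auto
  obtain j2 where j2: "j2 > 0" "\<And>q. prime q \<Longrightarrow> multiplicity q j2 = b q div 6 - a q div 6"
    using realize[of "\<lambda>a b. b div 6 - a div 6"] by auto
  note pos = p(1) e1(1) e2(1) n1(1) n2(1) j1(1) j2(1)
  note mults = p(2) e1(2) e2(2) n1(2) n2(2) j1(2) j2(2)
  \<comment> \<open>Taking multiplicities in \<open>x * y = z ^ 6\<close> gives the divisibility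
    required by \<open>exponent_decomposition\<close>.\<close>
  have six: "6 dvd a q + b q" if "prime q" for q
  proof -
    have "a q + b q = multiplicity q (x * y)"
      using assms that by (simp add: a_def b_def prime_elem_multiplicity_mult_distrib)
    also have "\<dots> = 6 * multiplicity q z"
      using assms that by (simp add: eq prime_elem_multiplicity_power_distrib)
    finally show ?thesis
      by simp
  qed
  have x: "x = p ^ 3 * e1 ^ 4 * e2 ^ 2 * n1 ^ 5 * n2 * j1 ^ 6" (is "_ = ?X")
  proof (rule multiplicity_eq_nat)
    fix q :: nat
    assume q: "prime q"
    have "multiplicity q ?X = 3 * multiplicity q p + 4 * multiplicity q e1
        + 2 * multiplicity q e2 + 5 * multiplicity q n1 + multiplicity q n2
        + 6 * multiplicity q j1"
      using q pos by (simp add: prime_elem_multiplicity_mult_distrib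
          prime_elem_multiplicity_power_distrib)
    also have "\<dots> = a q"
      unfolding mults[OF q] by (rule exponent_decomposition(1)[OF six[OF q], symmetric])
    finally show "multiplicity q x = multiplicity q ?X"
      by (simp only: a_def)
  qed (use assms pos in auto)
  have y: "y = p ^ 3 * e1 ^ 2 * e2 ^ 4 * n1 * n2 ^ 5 * j2 ^ 6" (is "_ = ?Y")
  proof (rule multiplicity_eq_nat)
    fix q :: nat
    assume q: "prime q"
    have "multiplicity q ?Y = 3 * multiplicity q p + 2 * multiplicity q e1
        + 4 * multiplicity q e2 + multiplicity q n1 + 5 * multiplicity q n2
        + 6 * multiplicity q j2"
      using q pos by (simp add: prime_elem_multiplicity_mult_distrib
          prime_elem_multiplicity_power_distrib)
    also have "\<dots> = b q"
      unfolding mults[OF q] by (rule exponent_decomposition(2)[OF six[OF q], symmetric])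
    finally show "multiplicity q y = multiplicity q ?Y"
      by (simp only: b_def)
  qed (use assms pos in auto)
  \<comment> \<open>No exponents of \<open>z\<close> are compared: both sides equal
    \<open>x * y\<close>, and sixth powers are injective on the naturals.\<close>
  have "z ^ 6 = (p * e1 * e2 * n1 * n2 * j1 * j2) ^ 6"
    using eq unfolding x y product by (rule sym)
  then have z: "z = p * e1 * e2 * n1 * n2 * j1 * j2"
    by (rule power_eq_imp_eq_base) auto
  \<comment> \<open>For \<open>e1\<close>, \<open>e2\<close> and for \<open>n1\<close>,
    \<open>n2\<close>, the indicators test different residues of \<open>a q\<close>, so at most one
    is nonzero. For \<open>j1\<close>, \<open>j2\<close>, one of two opposite truncated differences
    is zero.\<close>
  have "gcd e1 e2 = 1" "gcd n1 n2 = 1" "gcd j1 j2 = 1"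
    using pos by (auto intro!: coprime_of_multiplicities simp del: One_nat_def simp: mults)
  with pos x y z show ?rhs
    by (intro exI[of _ p] exI[of _ e1] exI[of _ e2] exI[of _ n1] exI[of _ n2]
        exI[of _ j1] exI[of _ j2] conjI)
qed

end
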